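(* Let $U,V\subset(0,\infty)$ be two non-empty open sets and let $f\colon(0,\infty)\to\mathbb{R}$ be continuous such that $(f(ku+v))_{k\ge1}\in\mathcal{G}$ for all $u\in U$ and $v\in V$. Then there exists an interval $J\subset(0,\infty)$ of positive length such that the restriction of $f$ to $J$ is a polynomial.
   Context: A sequence of real numbers $(a_k)_{k\ge1}$ is called pointwise good (written $(a_k)\in\mathcal{G}$) if for every measure preserving flow $(U_t)_{t\in\mathbb{R}}$ on a probability space $(X,\mathcal{B},\mu)$ (a measurable action of $\mathbb{R}$ by measure preserving transformations) and every $F\in L^\infty(X,\mu)$, the averages $\frac1n\sum_{k=1}^n F(U_{a_k}x)$ converge for $\mu$-almost every $x$ as $n\to\infty$. *)

theory Defs
  imports "HOL-Probability.Probability" "HOL-Computational_Algebra.Polynomial"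
begin

definition measure_preserving_flow :: "'a measure \<Rightarrow> (real \<Rightarrow> 'a \<Rightarrow> 'a) \<Rightarrow> bool" where
  "measure_preserving_flow M T \<longleftrightarrow>
     prob_space M \<and>
     (\<lambda>(t, x). T t x) \<in> measurable (borel \<Otimes>\<^sub>M M) M \<and>
     (\<forall>x\<in>space M. T 0 x = x) \<and>
     (\<forall>s t. \<forall>x\<in>space M. T (s + t) x = T s (T t x)) \<and>
     (\<forall>t. T t \<in> measurable M M \<and> distr M M (T t) = M)"

definition Linfty :: "'a measure \<Rightarrow> ('a \<Rightarrow> real) \<Rightarrow> bool" where
  "Linfty M F \<longleftrightarrow> F \<in> borel_measurable M \<and> (\<exists>C. AE x in M. \<bar>F x\<bar> \<le> C)"

text \<open>Pointwise good sequences (a_k), k \<ge> 1 (the value a 0 is ignored). The flows range over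
  probability spaces whose points are real numbers (every measure space of cardinality at most
  the continuum, in particular every standard probability space, is isomorphic to such a one).\<close>
definition pointwise_good :: "(nat \<Rightarrow> real) \<Rightarrow> bool" where
  "pointwise_good a \<longleftrightarrow>
     (\<forall>(M :: real measure) T F. measure_preserving_flow M T \<longrightarrow> Linfty M F \<longrightarrow>
        (AE x in M. convergent (\<lambda>n. (\<Sum>k=1..n. F (T (a k) x)) / real n)))"

end

theory Submission
  imports Defs "HOL-Real_Asymp.Real_Asymp"
begin

text \<open>
  A sequence \<open>a\<close> that is linearly independent over the integers is not pointwise good. By
  Kronecker's theorem there is, for each \<open>i\<close>, a speed \<open>\<theta>\<^sub>i\<close> such that the points \<open>a\<^sub>k \<theta>\<^sub>i\<close> mod 1 sit
  near \<open>m / L\<close> for all \<open>k\<close> in the lacunary block \<open>4\<^bsup>m-1\<^esup> < k \<le> 4\<^sup>m\<close>; hence some average along the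
  rotation of the circle with speed \<open>\<theta>\<^sub>i\<close> of the indicator of a very short arc is at least \<open>3/4\<close>,
  whatever the starting point. On the infinite torus with speeds \<open>\<theta>\<^sub>0, \<theta>\<^sub>1, \<dots>\<close>, the indicator of
  the event that some coordinate lies in its short arc has integral at most \<open>1/2\<close>, but all its
  averages have upper limit at least \<open>3/4\<close>, which is incompatible with almost sure convergence.

  So each \<open>(u, v)\<close> satisfies an integer relation between the values \<open>f (k u + v)\<close>. There
  are countably many relations, so by Baire one of them holds on an open box of \<open>(u, v)\<close>.
  Differencing in suitable directions isolates a single term and yields
  \<open>\<Delta>\<^sub>h\<^sup>m f = 0\<close> on an interval for all small \<open>h\<close>, so the continuous function \<open>f\<close> is a polynomial there.
\<close>

section \<open>Simultaneous Diophantine approximation\<close>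

lemma frac_add_of_int: "frac (x + of_int n) = frac x"
  by (simp add: frac_def)

text \<open>Averaging a trigonometric polynomial with its translate by \<open>\<pi> / \<lambda>\<close> removes the frequency \<open>\<lambda>\<close>
  without increasing the sup norm or changing the constant term.\<close>
lemma norm_zero_frequency_le:
  fixes c :: "'a \<Rightarrow> complex" and l :: "'a \<Rightarrow> real"
  assumes "finite G" and "\<And>t. norm (\<Sum>g\<in>G. c g * cis (l g * t)) \<le> B"
  shows "norm (\<Sum>g | g \<in> G \<and> l g = 0. c g) \<le> B"
proof -
  \<comment> \<open>The induction removes the nonzero frequencies \<open>N\<close> one at a time.
    The coefficients are generalised because every averaging step changes them.\<close>
  have zero_part: "norm (\<Sum>g\<in>Z. c g) \<le> B"
    if "finite N" "finite Z" "N \<inter> Z = {}" "\<And>g. g \<in> Z \<Longrightarrow> l g = 0" "\<And>g. g \<in> N \<Longrightarrow> l g \<noteq> 0"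
      "\<And>t. norm (\<Sum>g\<in>N \<union> Z. c g * cis (l g * t)) \<le> B" for N Z and c :: "'a \<Rightarrow> complex"
    using that
  proof (induction N arbitrary: c rule: finite_induct)
    case empty
    then have "norm (\<Sum>g\<in>Z. c g * cis (l g * 0)) \<le> B"
      by (metis Un_empty_left)
    then show ?case by simp
  next
    case (insert n N)
    define s where "s = pi / l n"
    define d where "d g = c g * (1 + cis (l g * s)) / 2" for g
    have ln: "l n \<noteq> 0" using insert.prems by auto
    have dn: "d n = 0" using ln by (simp add: d_def s_def)
    have dZ: "d g = c g" if "g \<in> Z" for g using insert.prems(3)[OF that] by (simp add: d_def)
    have split: "d g * cis (l g * t) = (c g * cis (l g * t) + c g * cis (l g * (t + s))) / 2" for g t
      by (simp add: d_def cis_mult [symmetric] ring_distribs)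
    have "norm (\<Sum>g\<in>N \<union> Z. d g * cis (l g * t)) \<le> B" for t
    proof -
      have "(\<Sum>g\<in>N \<union> Z. d g * cis (l g * t)) = (\<Sum>g\<in>insert n N \<union> Z. d g * cis (l g * t))"
        using insert dn by (intro sum.mono_neutral_left) auto
      also have "\<dots> = ((\<Sum>g\<in>insert n N \<union> Z. c g * cis (l g * t))
           + (\<Sum>g\<in>insert n N \<union> Z. c g * cis (l g * (t + s)))) / 2"
        unfolding split by (simp only: sum_divide_distrib [symmetric] sum.distrib)
      also have "norm \<dots> \<le> (B + B) / 2"
        using insert.prems(5)[of t] insert.prems(5)[of "t + s"]
        by (auto simp: norm_divide intro: order_trans[OF norm_triangle_ineq] )
      finally show ?thesis by simp
    qed
    then have "norm (\<Sum>g\<in>Z. d g) \<le> B"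
      using insert by (intro insert.IH) auto
    then show ?case using dZ by simp
  qed
  have G: "{g\<in>G. l g \<noteq> 0} \<union> {g\<in>G. l g = 0} = G" by auto
  show ?thesis
    by (rule zero_part[of "{g\<in>G. l g \<noteq> 0}"]) (use assms in \<open>auto simp: G\<close>)
qed

lemma norm_one_plus_cis: "(norm (1 + cis z))\<^sup>2 = 2 + 2 * cos z"
proof -
  have "(norm (1 + cis z))\<^sup>2 = (1 + cos z)\<^sup>2 + (sin z)\<^sup>2"
    by (simp add: cmod_power2)
  also have "\<dots> = 1 + 2 * cos z + ((cos z)\<^sup>2 + (sin z)\<^sup>2)" by (simp add: power2_eq_square algebra_simps)
  finally show ?thesis by simp
qed

text \<open>\<open>cos (2 * pi * x)\<close> depends only on the distance from \<open>x\<close> to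
  the nearest integer, and decreases with it. The two cases are the two halves of a period.\<close>

lemma cos_le_of_far_from_Ints:
  fixes x d :: real
  assumes "0 < d" "d \<le> 1/2" "\<And>h::int. d \<le> \<bar>x - of_int h\<bar>"
  shows "cos (2 * pi * x) \<le> cos (2 * pi * d)"
proof -
  define r where "r = frac x"
  have r: "0 \<le> r" "r < 1" by (auto simp: r_def frac_lt_1)
  have 1: "d \<le> r" using assms(3)[of "\<lfloor>x\<rfloor>"] r by (auto simp: r_def frac_def)
  have 2: "r \<le> 1 - d" using assms(3)[of "\<lfloor>x\<rfloor> + 1"] r by (auto simp: r_def frac_def)
  have "2 * pi * x = 2 * pi * r + 2 * pi * of_int \<lfloor>x\<rfloor>" by (simp add: r_def frac_def algebra_simps)
  then have c: "cos (2 * pi * x) = cos (2 * pi * r)"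
    by (simp add: cos_add)
  show ?thesis
  proof (cases "r \<le> 1/2")
    case True
    then show ?thesis unfolding c using 1 assms
      by (intro cos_monotone_0_pi_le) auto
  next
    case False
    have "cos (2 * pi * r) = cos (2 * pi * (1 - r))"
      by (simp add: right_diff_distrib cos_diff)
    also have "\<dots> \<le> cos (2 * pi * d)" using 2 False assms
      by (intro cos_monotone_0_pi_le) auto
    finally show ?thesis using c by simp
  qed
qed

text \<open>If no \<open>t\<close> works, the kernel \<open>\<Prod>\<^sub>k ((1 + e(x\<^sub>k)) / 2)\<^bsup>2q\<^esup> e(- q x\<^sub>k)\<close> with \<open>x\<^sub>k = t a\<^sub>k - y\<^sub>k\<close> is
  exponentially small in \<open>q\<close>, whereas by independence its constant term is only polynomially small.\<close>
theorem Kronecker_simultaneous: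
  fixes a y :: "nat \<Rightarrow> real"
  assumes "finite A" "0 < d"
    and indep: "\<And>c :: nat \<Rightarrow> int. (\<Sum>k\<in>A. of_int (c k) * a k) = 0 \<Longrightarrow> \<forall>k\<in>A. c k = 0"
  shows "\<exists>t. \<forall>k\<in>A. \<exists>h::int. \<bar>t * a k - y k - of_int h\<bar> < d"
proof (rule ccontr)
  assume contra: "\<not> ?thesis"
  \<comment> \<open>The cap 1/4 keeps \<open>2 * pi * e\<close> in (0, pi/2], where the cosine is
    strictly decreasing; this gives \<open>r < 1\<close>.\<close>
  define e where "e = min d (1/4)"
  have e: "0 < e" "e \<le> 1/2" "e \<le> d" using assms by (auto simp: e_def)
  define r where "r = (1 + cos (2 * pi * e)) / 2"
  have "cos (2 * pi * e) < cos 0"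
    using e by (intro cos_monotone_0_pi) auto
  then have r1: "r < 1" by (simp add: r_def)
  have half_cos_ge: "0 \<le> (1 + cos z) / 2" for z :: real
  proof -
    have "1 + (- 1) \<le> 1 + cos z" by (rule add_left_mono) simp
    then show ?thesis by simp
  qed
  have half_cos_le: "(1 + cos z) / 2 \<le> 1" for z :: real
    by simp
  note r = r1 half_cos_ge[of "2 * pi * e", folded r_def]
  define N where "N = card A"
  have bound: "1 / real (2 * q) ^ N \<le> r ^ q" if q: "q > 0" for q
  proof -
    \<comment> \<open>One factor of the kernel, written as an exponential sum so that the product
      over \<open>A\<close> can be expanded. Index \<open>j\<close> has frequency
      \<open>j - q\<close>, so \<open>j = q\<close> is the constant term.\<close>
    define P where "P x = (\<Sum>j\<le>2*q. complex_of_real (real ((2*q) choose j) / 4^q) * cis ((real j - real q) * (2*pi*x)))" for x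
    have P_eq: "P x = ((1 + cis (2*pi*x)) / 2) ^ (2*q) * cis (- real q * (2*pi*x))" for x
    proof -
      have "(1 + cis (2*pi*x)) ^ (2*q) = (\<Sum>j\<le>2*q. of_nat ((2*q) choose j) * cis (2*pi*x) ^ j)"
        using binomial_ring[of "cis (2*pi*x)" 1 "2*q"] by (simp add: add.commute)
      then have "((1 + cis (2*pi*x)) / 2) ^ (2*q) * cis (- real q * (2*pi*x))
        = (\<Sum>j\<le>2*q. of_nat ((2*q) choose j) * cis (2*pi*x) ^ j * cis (- real q * (2*pi*x))) / 4 ^ q"
        by (simp add: power_divide power_mult sum_distrib_right)
      also have "\<dots> = P x"
        unfolding P_def sum_divide_distrib
        by (intro sum.cong refl) (simp add: Complex.DeMoivre cis_mult algebra_simps)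
      finally show ?thesis by simp
    qed
    have nP: "norm (P x) = ((1 + cos (2*pi*x)) / 2) ^ q" for x
    proof -
      have "norm (P x) = ((norm (1 + cis (2*pi*x)) / 2)\<^sup>2) ^ q"
        unfolding P_eq by (simp add: norm_mult norm_power norm_divide power_mult)
      also have "(norm (1 + cis (2*pi*x)) / 2)\<^sup>2 = (1 + cos (2*pi*x)) / 2"
        by (simp add: power_divide norm_one_plus_cis)
      finally show ?thesis .
    qed
    have P1: "norm (P x) \<le> 1" for x
      unfolding nP by (intro power_le_one half_cos_ge half_cos_le)
    \<comment> \<open>For each \<open>t\<close> some \<open>k\<close> in \<open>A\<close> fails the
      approximation. Its factor is at most \<open>r ^ q\<close>, and all other factors are at most
      1.\<close>
    have K: "norm (\<Prod>k\<in>A. P (t * a k - y k)) \<le> r ^ q" for t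
    proof -
      obtain k where k: "k \<in> A" "\<And>h::int. d \<le> \<bar>t * a k - y k - of_int h\<bar>"
        using contra by (auto simp: not_less)
      have "norm (P (t * a k - y k)) \<le> r ^ q"
        unfolding nP r_def
        by (intro power_mono divide_right_mono add_left_mono cos_le_of_far_from_Ints half_cos_ge e
            order_trans[OF e(3) k(2)]) auto
      moreover have "norm (\<Prod>k\<in>A - {k}. P (t * a k - y k)) \<le> 1"
        unfolding prod_norm [symmetric] using P1 by (intro prod_le_1) auto
      ultimately have "norm (P (t * a k - y k)) * norm (\<Prod>k\<in>A - {k}. P (t * a k - y k)) \<le> r ^ q * 1"
        using r by (intro mult_mono) auto
      then show ?thesis
        using assms(1) k(1) by (simp add: prod.remove[of A k] norm_mult)
    qed
    \<comment> \<open>The expansion is indexed by the choices \<open>g\<close> of one term from each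
      factor: \<open>l g\<close> is the resulting frequency in \<open>t\<close>, and the phases from
      \<open>y\<close> are absorbed into \<open>C g\<close>.\<close>
    define C where "C g = (\<Prod>k\<in>A. complex_of_real (real ((2*q) choose (g k)) / 4^q) *
        cis ((real (g k) - real q) * (2*pi*(- y k))))" for g :: "nat \<Rightarrow> nat"
    define l where "l g = (\<Sum>k\<in>A. (real (g k) - real q) * (2*pi* a k))" for g :: "nat \<Rightarrow> nat"
    define G where "G = (PiE A (\<lambda>_. {..2*q}))"
    have cis_sum: "cis (sum z B) = (\<Prod>k\<in>B. cis (z k))" if "finite B" for z and B :: "nat set"
      using that by (induction B rule: finite_induct) (auto simp: cis_mult [symmetric])
    have expand: "(\<Prod>k\<in>A. P (t * a k - y k)) = (\<Sum>g\<in>G. C g * cis (l g * t))" for t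
    proof -
      have "(\<Prod>k\<in>A. P (t * a k - y k)) = (\<Sum>g\<in>G. \<Prod>k\<in>A.
         complex_of_real (real ((2*q) choose (g k)) / 4^q) * cis ((real (g k) - real q) * (2*pi*(t * a k - y k))))"
        unfolding P_def G_def using assms(1) by (subst prod_sum_PiE) auto
      also have "\<dots> = (\<Sum>g\<in>G. C g * cis (l g * t))"
        unfolding C_def l_def sum_distrib_right cis_sum[OF assms(1)] prod.distrib[symmetric]
        by (intro sum.cong prod.cong refl) (simp add: cis_mult algebra_simps)
      finally show ?thesis .
    qed
    have "finite G" using assms(1) by (auto simp: G_def intro: finite_PiE)
    then have le: "norm (\<Sum>g | g \<in> G \<and> l g = 0. C g) \<le> r ^ q"
      using K unfolding expand by (rule norm_zero_frequency_le)
    define g0 where "g0 = (\<lambda>k\<in>A. q)"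
    \<comment> \<open>A vanishing frequency is an integer relation with coefficients
      \<open>g k - q\<close>, so independence leaves only the choice of every middle term.\<close>
    have "{g\<in>G. l g = 0} = {g0}"
    proof (intro equalityI subsetI)
      fix g assume "g \<in> {g\<in>G. l g = 0}"
      then have g: "g \<in> G" "l g = 0" by auto
      have "l g = 2 * pi * (\<Sum>k\<in>A. of_int (int (g k) - int q) * a k)"
        unfolding l_def sum_distrib_left by (intro sum.cong) auto
      with g have "\<forall>k\<in>A. int (g k) - int q = 0" by (intro indep) auto
      then have "g = g0" using g(1) by (auto simp: G_def g0_def PiE_def extensional_def fun_eq_iff)
      then show "g \<in> {g0}" by simp
    qed (auto simp: g0_def G_def l_def)
    then have "norm (C g0) \<le> r ^ q" using le by simp
    moreover have "C g0 = of_real ((real ((2*q) choose q) / 4^q) ^ N)"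
      unfolding C_def N_def by (simp add: g0_def prod_constant)
    ultimately have "(real ((2*q) choose q) / 4^q) ^ N \<le> r ^ q"
      by (simp add: norm_power norm_divide)
    \<comment> \<open>The middle binomial coefficient is the largest, whence the polynomial lower
      bound for the constant term.\<close>
    moreover have "1 / real (2*q) \<le> real ((2*q) choose q) / 4^q"
      using central_binomial_lower_bound[OF q] q by (simp add: field_simps)
    then have "(1 / real (2*q)) ^ N \<le> (real ((2*q) choose q) / 4^q) ^ N"
      by (intro power_mono) auto
    ultimately show ?thesis by (simp add: power_one_over)
  qed
  have "(\<lambda>q. real q ^ N * r ^ q) \<longlonglongrightarrow> 0"
  proof (cases "r = 0")
    case True
    then show ?thesis by (intro tendsto_eventually eventually_sequentiallyI[of 1]) auto
  next
    case False
    with r have "0 < r" "r < 1" by auto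
    then show ?thesis by real_asymp
  qed
  then have "(\<lambda>q. 2 ^ N * (real q ^ N * r ^ q)) \<longlonglongrightarrow> 0"
    by (rule tendsto_mult_right_zero)
  then have "eventually (\<lambda>q. 2 ^ N * (real q ^ N * r ^ q) < 1) sequentially"
    by (rule order_tendstoD) simp
  then obtain q0 where "\<And>q. q \<ge> q0 \<Longrightarrow> 2 ^ N * (real q ^ N * r ^ q) < 1"
    by (auto simp: eventually_sequentially)
  then have "(2 * real (Suc q0)) ^ N * r ^ Suc q0 < 1"
    by (simp only: power_mult_distrib mult.assoc)
  moreover have "1 \<le> (2 * real (Suc q0)) ^ N * r ^ Suc q0"
    using bound[of "Suc q0", unfolded of_nat_mult of_nat_numeral]
    by (simp add: divide_le_eq mult.commute del: of_nat_Suc power_Suc)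
  ultimately show False by simp
qed

section \<open>Rotation speeds for which some averages concentrate on a short arc\<close>

text \<open>One \<theta> serves all starting points: as \<open>m\<close> runs through
  \<open>L\<close> consecutive block numbers, \<open>x + m / L\<close> meets every half-open arc of
  length \<open>1 / L\<close> modulo 1, so some block suits \<open>x\<close>. That block fills 3/4
  of \<open>{1..4 ^ m}\<close>.\<close>

lemma exists_concentrating_speed:
  fixes a :: "nat \<Rightarrow> real" and i :: nat
  assumes indep: "\<And>N (c :: nat \<Rightarrow> int). (\<Sum>k=1..N. of_int (c k) * a k) = 0 \<Longrightarrow> \<forall>k\<in>{1..N}. c k = 0"
    and "L > 0"
  shows "\<exists>\<theta>. \<forall>x. \<exists>n\<ge>i. n > 0 \<and> 3/4 * real n \<le> real (card {k\<in>{1..n}. frac (x + a k * \<theta>) < 3 / real L})"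
proof -
  \<comment> \<open>\<open>g k\<close> is the number of the block containing \<open>k\<close>; it
    determines the target \<open>g k / L\<close> for \<open>a k * \<theta>\<close>.\<close>
  define g where "g k = (LEAST m. k \<le> (4::nat) ^ m)" for k :: nat
  have g: "g k = m" if "4 ^ (m - 1) < k" "k \<le> 4 ^ m" "m > 0" for k m :: nat
    unfolding g_def
  proof (rule Least_equality)
    fix n assume "k \<le> 4 ^ n"
    with that have "(4::nat) ^ (m - 1) < 4 ^ n" by linarith
    then show "m \<le> n" using that by (simp add: power_strict_increasing_iff)
  qed fact
  \<comment> \<open>The range covers the \<open>L\<close> consecutive blocks \<open>i + 1\<close> to
    \<open>i + L\<close>; starting after \<open>i\<close> makes the time \<open>4 ^ m\<close> at
    least \<open>i\<close>.\<close>
  obtain \<theta> where \<theta>: "\<forall>k\<in>{1..4 ^ (i + L)}. \<exists>h::int. \<bar>\<theta> * a k - real (g k) / real L - of_int h\<bar> < 1 / real L"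
    using Kronecker_simultaneous[of "{1..4 ^ (i + L)}" "1 / real L" a "\<lambda>k. real (g k) / real L"] indep assms(2)
    by auto
  have "\<exists>n\<ge>i. n > 0 \<and> 3/4 * real n \<le> real (card {k\<in>{1..n}. frac (x + a k * \<theta>) < 3 / real L})" for x
  proof -
    \<comment> \<open>a block number m with x + m / L in [1/L, 2/L) modulo 1\<close>
    define b where "b = (- \<lfloor>real L * x\<rfloor> - int i) mod int L"
    have b: "0 \<le> b" "b < int L" using assms(2) by (auto simp: b_def)
    define m where "m = i + 1 + nat b"
    have m: "i < m" "m \<le> i + L" using b by (auto simp: m_def)
    obtain h :: int where h: "\<lfloor>real L * x\<rfloor> + int m = 1 + int L * h"
    proof -
      have "int L dvd b - (- \<lfloor>real L * x\<rfloor> - int i)" unfolding b_def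
        by (metis dvd_minus_mod minus_diff_eq dvd_minus_iff)
      then obtain h where "b - (- \<lfloor>real L * x\<rfloor> - int i) = int L * h" by (rule dvdE)
      with b show ?thesis by (intro that[of h]) (auto simp: m_def)
    qed
    have fl: "of_int \<lfloor>real L * x\<rfloor> \<le> real L * x" "real L * x < of_int \<lfloor>real L * x\<rfloor> + 1" by linarith+
    have "real_of_int (\<lfloor>real L * x\<rfloor> + int m) = real_of_int (1 + int L * h)" by (simp only: h)
    then have hr: "of_int \<lfloor>real L * x\<rfloor> + real m = 1 + real L * of_int h" by simp
    \<comment> \<open>Aiming at [1/L, 2/L) leaves room for an error below 1/L on both sides: the
      orbit point stays between 0 and 3/L, up to an integer.\<close>
    define v where "v = real L * x + real m - real L * of_int h"
    have v1: "1 \<le> v" using fl hr unfolding v_def by linarith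
    have v2: "v < 2" using fl hr unfolding v_def by linarith
    have "x + real m / real L - of_int h = v / real L" using assms(2) by (simp add: v_def field_simps)
    with v1 v2 have near: "1 / real L \<le> x + real m / real L - of_int h" "x + real m / real L - of_int h < 2 / real L"
      using assms(2) by (auto intro: divide_right_mono divide_strict_right_mono)
    have small: "frac (x + a k * \<theta>) < 3 / real L" if k: "4 ^ (m - 1) < k" "k \<le> 4 ^ m" for k
    proof -
      have "(4::nat) ^ m \<le> 4 ^ (i + L)" using m by (intro power_increasing) auto
      then have "k \<le> 4 ^ (i + L)" using k by linarith
      then have "k \<in> {1..4 ^ (i + L)}" using k by simp
      with \<theta> obtain h' :: int where "\<bar>\<theta> * a k - real (g k) / real L - of_int h'\<bar> < 1 / real L"
        by blast
      then have h': "\<bar>\<theta> * a k - real m / real L - of_int h'\<bar> < 1 / real L"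
        using g[OF k] m by simp
      define z where "z = x + a k * \<theta> - of_int (h + h')"
      have z: "0 \<le> z" "z < 3 / real L" using near h' by (auto simp: z_def abs_less_iff algebra_simps add_divide_distrib)
      have "x + a k * \<theta> = z + of_int (h + h')" by (simp add: z_def)
      then have "frac (x + a k * \<theta>) = frac z" by (simp only: frac_add_of_int)
      also have "\<dots> \<le> z" using z by (simp add: frac_def)
      finally show ?thesis using z by simp
    qed
    have sub: "{4 ^ (m - 1) <.. 4 ^ m} \<subseteq> {k\<in>{1..4 ^ m}. frac (x + a k * \<theta>) < 3 / real L}"
      using small by auto
    have "3/4 * real (4 ^ m) = real (card {4 ^ (m - 1) <.. (4::nat) ^ m})"
      using m by (cases m) (auto simp: of_nat_diff)
    also have "\<dots> \<le> real (card {k\<in>{1..4 ^ m}. frac (x + a k * \<theta>) < 3 / real L})"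
      using sub by (intro of_nat_mono card_mono) auto
    finally have "3/4 * real (4 ^ m) \<le> real (card {k\<in>{1..4 ^ m}. frac (x + a k * \<theta>) < 3 / real L})" .
    moreover have "i \<le> 4 ^ m" using m less_exp[of m] power_mono[of "2::nat" 4 m] by linarith
    ultimately show ?thesis by (intro exI[of _ "4 ^ m"]) auto
  qed
  then show ?thesis by blast
qed

section \<open>Linear flows on the infinite torus\<close>

text \<open>A product measure is determined by finite cylinders. The preimage of a cylinder is the
  cylinder over the preimages of its sides, whose measures are unchanged.\<close>

lemma distr_PiM_UNIV_componentwise:
  fixes M :: "'i \<Rightarrow> 'a measure"
  assumes M: "\<And>i. prob_space (M i)"
    and f [measurable]: "\<And>i. f i \<in> measurable (M i) (M i)"
    and pres: "\<And>i. distr (M i) (M i) (f i) = M i"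
  shows "distr (PiM UNIV M) (PiM UNIV M) (\<lambda>x i. f i (x i)) = PiM UNIV M"
proof -
  interpret product_prob_space M UNIV
    using M by (intro product_prob_spaceI) auto
  have meas: "(\<lambda>x i. f i (x i)) \<in> measurable (PiM UNIV M) (PiM UNIV M)"
  proof (rule measurable_PiM_single')
    show "(\<lambda>x. f i (x i)) \<in> measurable (PiM UNIV M) (M i)" for i by measurable
    show "(\<lambda>x i. f i (x i)) \<in> space (PiM UNIV M) \<rightarrow> (\<Pi>\<^sub>E i\<in>UNIV. space (M i))"
      using f[THEN measurable_space] by (auto simp: space_PiM PiE_iff)
  qed
  show ?thesis
  proof (rule PiM_eq)
    fix J F assume J: "finite J" "J \<subseteq> UNIV" "\<And>j. j \<in> J \<Longrightarrow> F j \<in> sets (M j)"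
    have sets: "f j -` F j \<inter> space (M j) \<in> sets (M j)" if "j \<in> J" for j
      using J that f by (auto intro: measurable_sets)
    have "(\<lambda>x i. f i (x i)) -` prod_emb UNIV M J (Pi\<^sub>E J F) \<inter> space (PiM UNIV M)
       = {x\<in>space (PiM UNIV M). \<forall>j\<in>J. x j \<in> f j -` F j \<inter> space (M j)}"
      using f[THEN measurable_space] by (auto simp: prod_emb_def space_PiM PiE_iff)
    moreover have "prod_emb UNIV M J (Pi\<^sub>E J F) \<in> sets (PiM UNIV M)"
      using J by (intro sets_PiM_I) auto
    ultimately have "emeasure (distr (PiM UNIV M) (PiM UNIV M) (\<lambda>x i. f i (x i))) (prod_emb UNIV M J (Pi\<^sub>E J F))
       = emeasure (PiM UNIV M) {x\<in>space (PiM UNIV M). \<forall>j\<in>J. x j \<in> f j -` F j \<inter> space (M j)}"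
      by (simp only: emeasure_distr[OF meas])
    also have "\<dots> = (\<Prod>j\<in>J. emeasure (M j) (f j -` F j \<inter> space (M j)))"
      using J sets by (intro emeasure_PiM_Collect) auto
    also have "\<dots> = (\<Prod>j\<in>J. emeasure (distr (M j) (M j) (f j)) (F j))"
      using J f by (intro prod.cong refl) (auto simp: emeasure_distr)
    finally show "emeasure (distr (PiM UNIV M) (PiM UNIV M) (\<lambda>x i. f i (x i))) (prod_emb UNIV M J (Pi\<^sub>E J F))
       = (\<Prod>j\<in>J. emeasure (M j) (F j))" by (simp add: pres)
  qed simp
qed

section \<open>The circle, the infinite torus and their rotations\<close>

text \<open>The group of reals modulo 1, with one representative per class; \<open>frac\<close> is
  the projection.\<close>

definition circle :: "real measure" where
  "circle = restrict_space lborel {0..<1}"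

lemma space_circle [simp]: "space circle = {0..<1}"
  by (simp add: circle_def space_restrict_space)

lemma prob_space_circle: "prob_space circle"
  by (intro prob_spaceI) (simp add: circle_def emeasure_restrict_space space_restrict_space)

lemma measurable_frac_circle [measurable (raw)]:
  assumes [measurable]: "g \<in> borel_measurable M"
  shows "(\<lambda>x. frac (g x)) \<in> measurable M circle"
proof -
  have "(\<lambda>x. frac (g x)) \<in> borel_measurable M" unfolding frac_def by measurable
  then show ?thesis
    unfolding circle_def by (intro measurable_restrict_space2) (auto simp: frac_lt_1)
qed

lemma measurable_circle_borel [measurable]: "(\<lambda>x. x) \<in> borel_measurable circle"
  unfolding circle_def by (intro measurable_restrict_space1) simp

text \<open>The preimage of a set splits where the rotation wraps around. The two pieces are
  translates, by \<open>\<sigma>\<close> and \<open>\<sigma> - 1\<close>, of complementary parts of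
  the set, so translation invariance of Lebesgue measure applies.\<close>

lemma rotation_preserves_circle: "distr circle circle (\<lambda>x. frac (x + s)) = circle"
proof (rule measure_eqI)
  show "sets (distr circle circle (\<lambda>x. frac (x + s))) = sets circle" by simp
next
  fix A assume "A \<in> sets (distr circle circle (\<lambda>x. frac (x + s)))"
  then have A: "A \<in> sets circle" by simp
  then have Ab [measurable]: "A \<in> sets borel" and A01: "A \<subseteq> {0..<1}"
    by (auto simp: circle_def sets_restrict_space_iff)
  define \<sigma> where "\<sigma> = frac s"
  have \<sigma>: "0 \<le> \<sigma>" "\<sigma> < 1" by (auto simp: \<sigma>_def frac_lt_1)
  have fr: "frac (x + s) = (if x + \<sigma> < 1 then x + \<sigma> else x + \<sigma> - 1)" if "0 \<le> x" "x < 1" for x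
    using that frac_eq[of x] by (simp add: frac_add \<sigma>_def)
  have shift: "emeasure lborel {x. x + c \<in> B} = emeasure lborel B" if [measurable]: "B \<in> sets borel" for B and c :: real
  proof -
    have "emeasure lborel B = emeasure (distr lborel borel ((+) c)) B" by (simp add: lborel_distr_plus)
    also have "\<dots> = emeasure lborel {x. x + c \<in> B}"
      by (subst emeasure_distr) (auto simp: vimage_def add.commute)
    finally show ?thesis by simp
  qed
  have "(\<lambda>x. frac (x + s)) -` A \<inter> space circle
      = {x. x + \<sigma> \<in> A \<inter> {\<sigma>..<1}} \<union> {x. x + (\<sigma> - 1) \<in> A \<inter> {0..<\<sigma>}}" (is "_ = ?P \<union> ?Q")
    using A01 \<sigma> by (auto simp: fr algebra_simps split: if_splits)
  moreover have "(\<lambda>x. frac (x + s)) -` A \<inter> space circle \<in> sets circle"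
    using A by (intro measurable_sets[OF _ A]) measurable
  ultimately have "emeasure (distr circle circle (\<lambda>x. frac (x + s))) A = emeasure circle (?P \<union> ?Q)"
    using A by (subst emeasure_distr) auto
  also have "\<dots> = emeasure lborel (?P \<union> ?Q)"
    unfolding circle_def using \<sigma> A01 by (intro emeasure_restrict_space) auto
  also have "\<dots> = emeasure lborel ?P + emeasure lborel ?Q"
    using \<sigma> by (intro plus_emeasure[symmetric]) (auto simp: lborel_def)
  also have "\<dots> = emeasure lborel (A \<inter> {\<sigma>..<1}) + emeasure lborel (A \<inter> {0..<\<sigma>})"
    by (subst (1 2) shift) auto
  also have "\<dots> = emeasure lborel ((A \<inter> {\<sigma>..<1}) \<union> (A \<inter> {0..<\<sigma>}))"
    by (intro plus_emeasure) auto
  also have "(A \<inter> {\<sigma>..<1}) \<union> (A \<inter> {0..<\<sigma>}) = A" using A01 \<sigma> by auto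
  also have "emeasure lborel A = emeasure circle A"
    unfolding circle_def using A01 by (intro emeasure_restrict_space[symmetric]) auto
  finally show "emeasure (distr circle circle (\<lambda>x. frac (x + s))) A = emeasure circle A" .
qed

definition torus :: "(nat \<Rightarrow> real) measure" where
  "torus = PiM UNIV (\<lambda>_. circle)"

definition torus_flow :: "(nat \<Rightarrow> real) \<Rightarrow> real \<Rightarrow> (nat \<Rightarrow> real) \<Rightarrow> nat \<Rightarrow> real" where
  "torus_flow \<theta> t x = (\<lambda>i. frac (x i + t * \<theta> i))"

lemma space_torus: "space torus = {x. \<forall>i. 0 \<le> x i \<and> x i < 1}"
  by (auto simp: torus_def space_PiM PiE_iff)

lemma measurable_torus_component [measurable]: "(\<lambda>x. x i) \<in> borel_measurable torus"
  unfolding torus_def by (rule measurable_compose[OF measurable_component_singleton]) (auto simp: measurable_circle_borel)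

lemma measure_preserving_torus_flow: "measure_preserving_flow torus (torus_flow \<theta>)"
  unfolding measure_preserving_flow_def
proof (intro conjI allI ballI)
  show "prob_space torus"
    unfolding torus_def by (intro prob_space_PiM prob_space_circle)
  have "(\<lambda>p i. frac (snd p i + fst p * \<theta> i)) \<in> measurable (borel \<Otimes>\<^sub>M torus) torus"
    unfolding torus_def
  proof (rule measurable_PiM_single')
    fix i
    have [measurable]: "(\<lambda>p. snd p i) \<in> borel_measurable (borel \<Otimes>\<^sub>M torus)"
      by (rule measurable_compose[OF measurable_snd measurable_torus_component])
    have "(\<lambda>p. frac (snd p i + fst p * \<theta> i)) \<in> measurable (borel \<Otimes>\<^sub>M torus) circle"
      by measurable
    then show "(\<lambda>p. frac (snd p i + fst p * \<theta> i)) \<in> measurable (borel \<Otimes>\<^sub>M Pi\<^sub>M UNIV (\<lambda>_. circle)) circle"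
      by (simp add: torus_def)
  qed (auto simp: frac_lt_1)
  then show joint: "(\<lambda>(t, x). torus_flow \<theta> t x) \<in> measurable (borel \<Otimes>\<^sub>M torus) torus"
    by (simp add: torus_flow_def case_prod_beta)
  show "torus_flow \<theta> 0 x = x" if "x \<in> space torus" for x
    using that by (auto simp: torus_flow_def space_torus frac_eq)
  show "torus_flow \<theta> (s + t) x = torus_flow \<theta> s (torus_flow \<theta> t x)" for s t x
  proof
    fix i
    have "frac (x i + t * \<theta> i) + s * \<theta> i = x i + (s + t) * \<theta> i + of_int (- \<lfloor>x i + t * \<theta> i\<rfloor>)"
      by (simp add: frac_def algebra_simps)
    then show "torus_flow \<theta> (s + t) x i = torus_flow \<theta> s (torus_flow \<theta> t x) i"
      unfolding torus_flow_def by (metis frac_add_of_int)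
  qed
  show "torus_flow \<theta> t \<in> measurable torus torus" for t
    using measurable_compose[OF measurable_Pair1'[of t borel torus] joint] by simp
  show "distr torus torus (torus_flow \<theta> t) = torus" for t
    unfolding torus_def torus_flow_def
    by (intro distr_PiM_UNIV_componentwise prob_space_circle rotation_preserves_circle) measurable
qed

section \<open>Transfer of flows to probability spaces of real numbers\<close>

text \<open>\<open>pointwise_good\<close> speaks only of measures on the reals, so the torus has to
  be embedded there. Reals are coded as sets of naturals, and pairing merges a sequence of such sets
  into one.\<close>

lemma ex_inj_real_sequences: "\<exists>\<phi> :: (nat \<Rightarrow> real) \<Rightarrow> real. inj \<phi>"
proof -
  obtain b :: "nat set \<Rightarrow> real" where b: "bij b"
    using nat_sets_eqpoll_reals unfolding eqpoll_def by auto
  define c where "c = inv b"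
  have c: "inj c" using b by (simp add: c_def bij_imp_bij_inv bij_is_inj)
  define \<phi> where "\<phi> x = b {prod_encode (i, n) | i n. n \<in> c (x i)}" for x :: "nat \<Rightarrow> real"
  have "inj \<phi>"
  proof (rule injI)
    fix x y assume "\<phi> x = \<phi> y"
    then have "{prod_encode (i, n) | i n. n \<in> c (x i)} = {prod_encode (i, n) | i n. n \<in> c (y i)}" (is "?X = ?Y")
      using b by (simp add: \<phi>_def bij_def inj_eq)
    moreover have "prod_encode (i, n) \<in> ?X \<longleftrightarrow> n \<in> c (x i)" "prod_encode (i, n) \<in> ?Y \<longleftrightarrow> n \<in> c (y i)" for i n
      by auto
    ultimately have "c (x i) = c (y i)" for i by blast
    then show "x = y" using c by (auto simp: inj_eq)
  qed
  then show ?thesis by blast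
qed

text \<open>Conjugating the flow by \<open>\<phi>\<close> gives a flow on the image measure, to
  which the definition applies; almost sure convergence is then pulled back along
  \<open>\<phi>\<close>.\<close>

lemma pointwise_good_embeddable:
  fixes M :: "'b measure" and \<phi> :: "'b \<Rightarrow> real"
  assumes good: "pointwise_good a" and flow: "measure_preserving_flow M T" and F: "Linfty M F"
    and \<phi>: "inj \<phi>"
  shows "AE x in M. convergent (\<lambda>n. (\<Sum>k=1..n. F (T (a k) x)) / real n)"
proof -
  \<comment> \<open>The measurable sets of \<open>embed_measure\<close> are the images of those of
    \<open>M\<close>, which makes both \<open>\<phi>\<close> and its inverse measurable.\<close>
  define N where "N = embed_measure M \<phi>"
  define \<psi> where "\<psi> = inv \<phi>"
  have \<psi>\<phi>: "\<psi> (\<phi> x) = x" for x using \<phi> by (simp add: \<psi>_def)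
  interpret M: prob_space M using flow by (simp add: measure_preserving_flow_def)
  have \<phi>m: "\<phi> \<in> measurable M N" unfolding N_def using \<phi> by (rule measurable_embed_measure2)
  have N: "N = distr M N \<phi>" unfolding N_def using \<phi> by (rule embed_measure_eq_distr)
  have \<psi>m: "\<psi> \<in> measurable N M"
    unfolding N_def by (rule measurable_embed_measure1) (simp add: \<psi>\<phi>)
  have joint: "(\<lambda>(t, x). T t x) \<in> measurable (borel \<Otimes>\<^sub>M M) M"
    and T: "\<And>t. T t \<in> measurable M M" "\<And>t. distr M M (T t) = M"
    and T0: "\<And>x. x \<in> space M \<Longrightarrow> T 0 x = x"
    and Tadd: "\<And>s t x. x \<in> space M \<Longrightarrow> T (s + t) x = T s (T t x)"
    using flow by (auto simp: measure_preserving_flow_def)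
  have space_N: "space N = \<phi> ` space M" by (simp add: N_def space_embed_measure)
  define T' where "T' t y = \<phi> (T t (\<psi> y))" for t y
  have T'm: "T' t \<in> measurable N N" for t
    unfolding T'_def by (intro measurable_compose[OF \<psi>m] measurable_compose[OF T(1)] \<phi>m)
  have "measure_preserving_flow N T'"
    unfolding measure_preserving_flow_def
  proof (intro conjI allI ballI)
    show "prob_space N" by (subst N) (rule M.prob_space_distr[OF \<phi>m])
    have "(\<lambda>p. \<phi> ((\<lambda>(t, x). T t x) (fst p, \<psi> (snd p)))) \<in> measurable (borel \<Otimes>\<^sub>M N) N"
      by (intro measurable_compose[OF _ \<phi>m] measurable_compose[OF _ joint] measurable_Pair
          measurable_fst measurable_compose[OF measurable_snd \<psi>m])
    then show "(\<lambda>(t, x). T' t x) \<in> measurable (borel \<Otimes>\<^sub>M N) N"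
      by (simp add: T'_def case_prod_beta)
    show "T' 0 x = x" if "x \<in> space N" for x
      using that by (auto simp: space_N T'_def \<psi>\<phi> T0)
    show "T' (s + t) x = T' s (T' t x)" if "x \<in> space N" for s t x
      using that by (auto simp: space_N T'_def \<psi>\<phi> Tadd)
    show "T' t \<in> measurable N N" for t by (rule T'm)
    show "distr N N (T' t) = N" for t
    proof -
      have "distr N N (T' t) = distr (distr M N \<phi>) N (T' t)" using N by simp
      also have "\<dots> = distr M N (\<lambda>x. \<phi> (T t x))"
        by (subst distr_distr[OF T'm \<phi>m]) (simp add: comp_def T'_def \<psi>\<phi>)
      also have "\<dots> = distr (distr M M (T t)) N \<phi>"
        by (subst distr_distr[OF \<phi>m T(1)]) (simp add: comp_def)
      also have "\<dots> = N" using N T(2) by simp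
      finally show ?thesis .
    qed
  qed
  moreover have "Linfty N (\<lambda>y. F (\<psi> y))"
  proof -
    from F obtain C where Fm: "F \<in> borel_measurable M" and C: "AE x in M. \<bar>F x\<bar> \<le> C"
      by (auto simp: Linfty_def)
    have m: "(\<lambda>y. F (\<psi> y)) \<in> borel_measurable N" using \<psi>m Fm by (rule measurable_compose)
    then have "{y \<in> space N. \<bar>F (\<psi> y)\<bar> \<le> C} \<in> sets N" by measurable
    then have "(AE y in distr M N \<phi>. \<bar>F (\<psi> y)\<bar> \<le> C) \<longleftrightarrow> (AE x in M. \<bar>F (\<psi> (\<phi> x))\<bar> \<le> C)"
      by (rule AE_distr_iff[OF \<phi>m])
    with C have "AE y in distr M N \<phi>. \<bar>F (\<psi> y)\<bar> \<le> C" by (simp add: \<psi>\<phi>)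
    then have "AE y in N. \<bar>F (\<psi> y)\<bar> \<le> C" by (simp only: N [symmetric])
    with m show ?thesis by (auto simp: Linfty_def)
  qed
  ultimately have "AE y in N. convergent (\<lambda>n. (\<Sum>k=1..n. F (\<psi> (T' (a k) y))) / real n)"
    using good by (auto simp: pointwise_good_def)
  then have "AE y in distr M N \<phi>. convergent (\<lambda>n. (\<Sum>k=1..n. F (\<psi> (T' (a k) y))) / real n)"
    by (simp only: N [symmetric])
  from AE_distrD[OF \<phi>m this] show ?thesis by (simp add: T'_def \<psi>\<phi>)
qed

section \<open>Large averages against a small integral\<close>

text \<open>By invariance every average has the integral of \<open>F\<close>, and by dominated
  convergence so does their limit. The limit is at least \<open>c\<close> because arbitrarily late
  averages are.\<close>

lemma integral_ge_of_recurrent_large_averages: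
  fixes F :: "'b \<Rightarrow> real"
  assumes flow: "measure_preserving_flow M T"
    and Fm: "F \<in> borel_measurable M" and F: "\<And>x. 0 \<le> F x" "\<And>x. F x \<le> 1"
    and conv: "AE x in M. convergent (\<lambda>n. (\<Sum>k=1..n. F (T (a k) x)) / real n)"
    and large: "\<And>x i. x \<in> space M \<Longrightarrow> \<exists>n\<ge>i. c \<le> (\<Sum>k=1..n. F (T (a k) x)) / real n"
  shows "c \<le> integral\<^sup>L M F"
proof -
  interpret prob_space M using flow by (simp add: measure_preserving_flow_def)
  have T: "\<And>t. T t \<in> measurable M M" "\<And>t. distr M M (T t) = M"
    using flow by (auto simp: measure_preserving_flow_def)
  define A where "A n x = (\<Sum>k=1..n. F (T (a k) x)) / real n" for n x
  have FTm: "(\<lambda>x. F (T t x)) \<in> borel_measurable M" for t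
    using T(1) Fm by (rule measurable_compose)
  have FTi: "integrable M (\<lambda>x. F (T t x))" for t
    using F FTm by (intro integrable_const_bound[where B=1]) auto
  have intFT: "(\<integral>x. F (T t x) \<partial>M) = integral\<^sup>L M F" for t
    using integral_distr[OF T(1) Fm, of t] by (simp add: T(2))
  have Am [measurable]: "A n \<in> borel_measurable M" for n
    unfolding A_def using FTm by measurable
  have A0: "0 \<le> A n x" for n x unfolding A_def using F by (auto intro!: divide_nonneg_nonneg sum_nonneg)
  have A1: "A n x \<le> 1" for n x
  proof -
    have "(\<Sum>k=1..n. F (T (a k) x)) \<le> (\<Sum>k=1..n. 1)" using F by (intro sum_mono) auto
    then show ?thesis unfolding A_def by (cases "n = 0") (auto simp: field_simps)
  qed
  have intA: "integral\<^sup>L M (A n) = integral\<^sup>L M F" if "n > 0" for n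
    unfolding A_def using that FTi by (simp add: Bochner_Integration.integral_sum intFT)
  \<comment> \<open>\<open>lim\<close> supplies a measurable limit function on the whole space; its
    values off the set of convergence do not affect the integral.\<close>
  have lim: "AE x in M. (\<lambda>n. A n x) \<longlonglongrightarrow> lim (\<lambda>n. A n x)"
    using conv unfolding A_def convergent_LIMSEQ_iff .
  have limm: "(\<lambda>x. lim (\<lambda>n. A n x)) \<in> borel_measurable M" by measurable
  have "(\<lambda>n. integral\<^sup>L M (A n)) \<longlonglongrightarrow> (\<integral>x. lim (\<lambda>n. A n x) \<partial>M)"
    using lim limm A0 A1 by (intro integral_dominated_convergence[where w="\<lambda>_. 1"]) auto
  moreover have "(\<lambda>n. integral\<^sup>L M (A n)) \<longlonglongrightarrow> integral\<^sup>L M F"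
    using intA by (intro tendsto_eventually eventually_sequentiallyI[of 1]) auto
  ultimately have eq: "(\<integral>x. lim (\<lambda>n. A n x) \<partial>M) = integral\<^sup>L M F" by (rule LIMSEQ_unique)
  have bounds: "AE x in M. c \<le> lim (\<lambda>n. A n x) \<and> norm (lim (\<lambda>n. A n x)) \<le> 1"
    using lim AE_space
  proof eventually_elim
    case (elim x)
    have "c \<le> lim (\<lambda>n. A n x)"
    proof (rule ccontr)
      assume "\<not> ?thesis"
      then have "eventually (\<lambda>n. A n x < c) sequentially"
        using elim by (intro order_tendstoD) auto
      then obtain i where "\<And>n. n \<ge> i \<Longrightarrow> A n x < c" by (auto simp: eventually_sequentially)
      with large[OF elim(2), of i] show False unfolding A_def by (meson not_less)
    qed
    moreover have "0 \<le> lim (\<lambda>n. A n x)" using elim(1) A0 by (intro LIMSEQ_le_const) auto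
    moreover have "lim (\<lambda>n. A n x) \<le> 1" using elim(1) A1 by (intro LIMSEQ_le_const2) auto
    ultimately show ?case by auto
  qed
  have "(\<integral>x. c \<partial>M) \<le> (\<integral>x. lim (\<lambda>n. A n x) \<partial>M)"
    using bounds limm by (intro integral_mono_AE integrable_const integrable_const_bound[where B=1]) auto
  then show ?thesis using eq by (simp add: prob_space)
qed

text \<open>Countable subadditivity: the \<open>i\<close>-th event constrains one coordinate only
  and has measure \<open>e i\<close>.\<close>

lemma torus_union_measure_le:
  assumes "\<And>i. 0 \<le> e i" "\<And>i. e i \<le> 1" "e sums s"
  shows "measure torus {x\<in>space torus. \<exists>i. x i < e i} \<le> s"
proof -
  interpret product_prob_space "\<lambda>_. circle" "UNIV :: nat set"
    using prob_space_circle by (intro product_prob_spaceI) auto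
  have s: "0 \<le> s" using assms by (metis sums_le sums_zero)
  define E where "E i = {x\<in>space torus. x i < e i}" for i
  have E [measurable]: "E i \<in> sets torus" for i unfolding E_def by measurable
  have ball: "emeasure torus (E i) = ennreal (e i)" for i
  proof -
    have "E i = {x\<in>space torus. x i \<in> {0..<e i}}"
      using assms by (auto simp: E_def space_torus)
    then have "emeasure torus (E i) = emeasure circle {0..<e i}"
      using assms(2) unfolding torus_def
      by (subst emeasure_PiM_Collect_single[symmetric, of i])
         (auto simp: circle_def sets_restrict_space_iff intro: order.strict_trans2)
    also have "\<dots> = emeasure lborel {0..<e i}"
      unfolding circle_def using assms(2) by (intro emeasure_restrict_space) (auto intro: order.strict_trans2)
    finally show ?thesis using assms(1) by simp
  qed
  have "emeasure torus (\<Union>i. E i) \<le> (\<Sum>i. emeasure torus (E i))"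
    by (intro emeasure_subadditive_countably) auto
  also have "\<dots> = ennreal s"
    unfolding ball using assms by (simp add: sums_iff suminf_ennreal2)
  finally have "measure torus (\<Union>i. E i) \<le> s"
    using s by (simp add: measure_def enn2real_leI)
  moreover have "(\<Union>i. E i) = {x\<in>space torus. \<exists>i. x i < e i}" by (auto simp: E_def)
  ultimately show ?thesis by simp
qed

lemma ex_integer_relation_of_pointwise_good:
  assumes good: "pointwise_good a"
  shows "\<exists>N (c :: nat \<Rightarrow> int). (\<exists>k\<in>{1..N}. c k \<noteq> 0) \<and> (\<Sum>k=1..N. of_int (c k) * a k) = 0"
proof (rule ccontr)
  assume "\<not> ?thesis"
  then have indep: "\<And>N (c :: nat \<Rightarrow> int). (\<Sum>k=1..N. of_int (c k) * a k) = 0 \<Longrightarrow> \<forall>k\<in>{1..N}. c k = 0"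
    by blast
  \<comment> \<open>The arc lengths sum to 1/2, which is below 3/4. Below,
    \<open>L = 12 * 2 ^ i\<close> makes \<open>3 / L\<close> equal to \<open>e i\<close>.\<close>
  define e :: "nat \<Rightarrow> real" where "e i = 1/4 * (1/2) ^ i" for i
  have "\<exists>\<theta>. \<forall>x. \<exists>n\<ge>i. n > 0 \<and> 3/4 * real n \<le> real (card {k\<in>{1..n}. frac (x + a k * \<theta>) < e i})" for i
    using exists_concentrating_speed[OF indep, where L = "3 * 4 * 2 ^ i" and i = i]
    by (simp add: e_def power_one_over field_simps)
  then have "\<exists>\<theta>. \<forall>i x. \<exists>n\<ge>i. n > 0 \<and>
      3/4 * real n \<le> real (card {k\<in>{1..n}. frac (x + a k * \<theta> i) < e i})"
    by (intro choice allI)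
  then obtain \<theta> where \<theta>: "\<And>i x. \<exists>n\<ge>i. n > 0 \<and>
      3/4 * real n \<le> real (card {k\<in>{1..n}. frac (x + a k * \<theta> i) < e i})"
    by blast
  define F :: "(nat \<Rightarrow> real) \<Rightarrow> real" where "F = indicator {x. \<exists>i. x i < e i}"
  have flow: "measure_preserving_flow torus (torus_flow \<theta>)" by (rule measure_preserving_torus_flow)
  interpret prob_space torus using flow by (simp add: measure_preserving_flow_def)
  have Fm: "F \<in> borel_measurable torus" unfolding F_def by measurable
  have F: "0 \<le> F x" "F x \<le> 1" for x by (auto simp: F_def indicator_def)
  obtain \<phi> :: "(nat \<Rightarrow> real) \<Rightarrow> real" where "inj \<phi>" using ex_inj_real_sequences by blast
  moreover have "Linfty torus F" using Fm F by (auto simp: Linfty_def intro!: exI[of _ 1])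
  ultimately have conv: "AE x in torus. convergent (\<lambda>n. (\<Sum>k=1..n. F (torus_flow \<theta> (a k) x)) / real n)"
    using pointwise_good_embeddable[OF good flow] by blast
  \<comment> \<open>Coordinate \<open>i\<close> alone forces a large average at some time
    \<open>n \<ge> i\<close>, since \<open>F\<close> dominates the indicator of its arc. Letting
    \<open>i\<close> vary gives arbitrarily late times.\<close>
  have large: "\<exists>n\<ge>i. 3/4 \<le> (\<Sum>k=1..n. F (torus_flow \<theta> (a k) x)) / real n" for x i
  proof -
    obtain n where n: "n \<ge> i" "n > 0"
      "3/4 * real n \<le> real (card {k\<in>{1..n}. frac (x i + a k * \<theta> i) < e i})" using \<theta> by blast
    have "real (card {k\<in>{1..n}. frac (x i + a k * \<theta> i) < e i})
        = (\<Sum>k=1..n. if frac (x i + a k * \<theta> i) < e i then 1 else 0)"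
      by (simp add: sum.If_cases Int_def)
    also have "\<dots> \<le> (\<Sum>k=1..n. F (torus_flow \<theta> (a k) x))"
      by (intro sum_mono) (auto simp: F_def torus_flow_def indicator_def)
    finally have "3/4 * real n \<le> (\<Sum>k=1..n. F (torus_flow \<theta> (a k) x))" using n by linarith
    with n show ?thesis by (intro exI[of _ n]) (auto simp: le_divide_eq)
  qed
  have "3/4 \<le> integral\<^sup>L torus F"
    by (rule integral_ge_of_recurrent_large_averages[OF flow Fm F conv]) (rule large)
  also have "integral\<^sup>L torus F = measure torus {x\<in>space torus. \<exists>i. x i < e i}"
    unfolding F_def by (simp add: Int_def conj_commute)
  also have "\<dots> \<le> 1/2"
  proof (rule torus_union_measure_le)
    show "0 \<le> e i" "e i \<le> 1" for i
      using power_le_one[of "1/2 :: real" i] by (auto simp: e_def)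
    show "e sums (1/2)"
      unfolding e_def using sums_mult[OF geometric_sums[of "1/2 :: real"], of "1/4"] by simp
  qed
  finally show False by simp
qed

section \<open>Finite differences and polynomials\<close>

definition fwd_diff :: "real \<Rightarrow> (real \<Rightarrow> real) \<Rightarrow> real \<Rightarrow> real" where
  "fwd_diff h g = (\<lambda>x. g (x + h) - g x)"

lemma fwd_diff_funpow_Suc:
  "(fwd_diff h ^^ Suc n) g x = (fwd_diff h ^^ n) g (x + h) - (fwd_diff h ^^ n) g x"
  by (simp add: fwd_diff_def)

lemma fwd_diff_funpow_diff:
  "(fwd_diff h ^^ n) (\<lambda>x. f x - g x) x = (fwd_diff h ^^ n) f x - (fwd_diff h ^^ n) g x"
  by (induction n arbitrary: x) (simp_all add: fwd_diff_def)

text \<open>In the \<open>n\<close>-th difference the last node carries coefficient 1. This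
  propagates zeros along a grid: if the difference and the first \<open>n\<close> values vanish, so
  does the next value.\<close>

lemma fwd_diff_funpow_vanishing:
  assumes "\<And>i. i < n \<Longrightarrow> g (x + real i * h) = 0"
  shows "(fwd_diff h ^^ n) g x = g (x + real n * h)"
  using assms
proof (induction n arbitrary: x)
  case (Suc n)
  have "g (x + h + real i * h) = 0" if "i < n" for i
    using Suc.prems[of "Suc i"] that by (simp add: algebra_simps)
  then have "(fwd_diff h ^^ n) g (x + h) = g (x + h + real n * h)" by (rule Suc.IH)
  moreover have "(fwd_diff h ^^ n) g x = g (x + real n * h)" using Suc.prems by (intro Suc.IH) auto
  ultimately show ?case
    unfolding fwd_diff_funpow_Suc using Suc.prems[of n] by (simp add: algebra_simps)
qed simp

text \<open>Translation preserves the degree and the leading coefficient, so the leading terms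
  cancel.\<close>

lemma degree_fwd_diff:
  fixes p :: "real poly"
  assumes "degree p \<le> Suc n"
  shows "degree (pcompose p [:h, 1:] - p) \<le> n"
proof (rule degree_le, intro allI impI)
  fix i assume i: "n < i"
  show "coeff (pcompose p [:h, 1:] - p) i = 0"
  proof (cases "i = Suc n \<and> degree p = Suc n")
    case True
    have "lead_coeff (pcompose p [:h, 1:]) = lead_coeff p"
      by (subst lead_coeff_comp) auto
    moreover have "degree (pcompose p [:h, 1:]) = degree p" by (simp add: degree_pcompose)
    ultimately show ?thesis using True by simp
  next
    case False
    then have "degree p < i" using i assms by auto
    moreover have "degree (pcompose p [:h, 1:]) = degree p" by (simp add: degree_pcompose)
    ultimately show ?thesis by (simp add: coeff_eq_0)
  qed
qed

lemma fwd_diff_funpow_poly: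
  assumes "degree p < n"
  shows "(fwd_diff h ^^ n) (poly p) x = 0"
  using assms
proof (induction n arbitrary: p x)
  case (Suc n)
  have eq: "fwd_diff h (poly p) = poly (pcompose p [:h, 1:] - p)"
    by (auto simp: fwd_diff_def poly_pcompose add.commute)
  show ?case
  proof (cases n)
    \<comment> \<open>The difference of a constant is zero, whose degree is again 0, so the degree
      count cannot handle this case.\<close>
    case 0
    with Suc.prems obtain c where "p = [:c:]" using degree_eq_zeroE by auto
    then show ?thesis using 0 by (simp add: fwd_diff_def)
  next
    case (Suc m)
    have "degree (pcompose p [:h, 1:] - p) < n"
      using degree_fwd_diff[of p m h] Suc.prems Suc by simp
    then have "(fwd_diff h ^^ n) (fwd_diff h (poly p)) x = 0"
      unfolding eq by (rule Suc.IH)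
    then show ?thesis by (simp add: funpow_Suc_right del: funpow.simps)
  qed
qed simp

text \<open>Newton interpolation: a multiple of the polynomial \<open>w\<close> vanishing at the old
  nodes corrects the value at the new one.\<close>

lemma ex_interpolating_poly:
  fixes f :: "real \<Rightarrow> real"
  assumes "finite A" "A \<noteq> {}"
  shows "\<exists>p. degree p < card A \<and> (\<forall>x\<in>A. poly p x = f x)"
  using assms
proof (induction A rule: finite_ne_induct)
  case (singleton x)
  then show ?case by (intro exI[of _ "[:f x:]"]) auto
next
  case (insert x A)
  then obtain p where p: "degree p < card A" "\<forall>x\<in>A. poly p x = f x" by blast
  define w where "w = (\<Prod>y\<in>A. [:- y, 1:])"
  have wA: "poly w y = 0" if "y \<in> A" for y
    using that insert by (auto simp: w_def poly_prod)
  have wx: "poly w x \<noteq> 0" using insert by (auto simp: w_def poly_prod)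
  have dw: "degree w = card A"
    unfolding w_def by (subst degree_prod_sum_eq) auto
  define q where "q = p + smult ((f x - poly p x) / poly w x) w"
  have "degree q \<le> card A"
    unfolding q_def using p dw by (intro degree_add_le) (auto intro: order_trans[OF degree_smult_le])
  then have "degree q < card (insert x A)" using insert by simp
  moreover have "poly q y = f y" if "y \<in> insert x A" for y
    using that p wA wx by (auto simp: q_def)
  ultimately show ?case by blast
qed

text \<open>On each grid, interpolation at the first \<open>m\<close> nodes extends to all nodes by
  the vanishing differences. All grids share the nodes of the coarsest one, so the polynomials
  agree; density and continuity finish.\<close>

lemma poly_on_interval_of_fwd_diff_zero:
  fixes f :: "real \<Rightarrow> real"
  assumes "a < b" "0 < m" and cont: "continuous_on {a..b} f"
    and zero: "\<And>x h. a \<le> x \<Longrightarrow> 0 < h \<Longrightarrow> x + real m * h \<le> b \<Longrightarrow> (fwd_diff h ^^ m) f x = 0"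
  shows "\<exists>p. \<forall>x\<in>{a..b}. f x = poly p x"
proof -
  \<comment> \<open>The mesh is chosen so that \<open>m * q\<close> steps run exactly from
    \<open>a\<close> to \<open>b\<close>.\<close>
  define w where "w q = (b - a) / (real m * real q)" for q :: nat
  have w: "w q > 0" if "q > 0" for q using assms that by (simp add: w_def)
  have grid: "\<exists>p. degree p < m \<and> (\<forall>j\<le>m * q. f (a + real j * w q) = poly p (a + real j * w q))"
    if q: "q > 0" for q
  proof -
    define A where "A = (\<lambda>j. a + real j * w q) ` {..<m}"
    have cA: "card A = m" unfolding A_def using w[OF q] by (subst card_image) (auto simp: inj_on_def)
    have "finite A" "A \<noteq> {}" using assms by (auto simp: A_def)
    then obtain p where p: "degree p < m" "\<forall>x\<in>A. poly p x = f x"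
      using ex_interpolating_poly[of A f] unfolding cA by blast
    have "f (a + real j * w q) = poly p (a + real j * w q)" if "j \<le> m * q" for j
      using that
    proof (induction j rule: less_induct)
      case (less j)
      show ?case
      proof (cases "j < m")
        case True
        then show ?thesis using p by (auto simp: A_def)
      next
        case False
        \<comment> \<open>The window of \<open>m + 1\<close> nodes from \<open>i\<close> to
          \<open>j\<close>: the error vanishes at all but the last by induction, hence also
          there.\<close>
        define i where "i = j - m"
        have j: "j = i + m" using False by (simp add: i_def)
        define g where "g x = f x - poly p x" for x
        define x where "x = a + real i * w q"
        have xh: "x + real l * w q = a + real (i + l) * w q" for l
          by (simp add: x_def algebra_simps)
        have "real j * w q \<le> real (m * q) * w q"
          using less.prems w[OF q] by (intro mult_right_mono) (simp_all only: of_nat_le_iff less_imp_le)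
        also have "\<dots> = b - a" using assms q by (simp add: w_def)
        finally have "x + real m * w q \<le> b" unfolding xh using j by simp
        moreover have "a \<le> x" using w[OF q] by (simp add: x_def)
        ultimately have "(fwd_diff (w q) ^^ m) g x = 0"
          unfolding g_def fwd_diff_funpow_diff using p w[OF q] zero fwd_diff_funpow_poly by simp
        moreover have "(fwd_diff (w q) ^^ m) g x = g (x + real m * w q)"
        proof (rule fwd_diff_funpow_vanishing)
          fix l assume "l < m"
          then show "g (x + real l * w q) = 0"
            using less.IH[of "i + l"] less.prems unfolding xh by (simp add: g_def j)
        qed
        ultimately show ?thesis unfolding xh by (simp add: g_def j)
      qed
    qed
    with p show ?thesis by blast
  qed
  then obtain P where P: "\<And>q. q > 0 \<Longrightarrow> degree (P q) < m"
    "\<And>q j. q > 0 \<Longrightarrow> j \<le> m * q \<Longrightarrow> f (a + real j * w q) = poly (P q) (a + real j * w q)"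
    by metis
  define p where "p = P 1"
  \<comment> \<open>Since \<open>w 1 = q * w q\<close>, both polynomials equal \<open>f\<close> at
    the first \<open>m\<close> nodes of the coarsest grid, and their degrees are below
    \<open>m\<close>.\<close>
  have Pq: "P q = p" if q: "q > 0" for q
  proof (rule poly_eqI_degree[where A = "(\<lambda>j. a + real j * w 1) ` {..<m}"])
    have c: "card ((\<lambda>j. a + real j * w 1) ` {..<m}) = m"
      using w[of 1] by (subst card_image) (auto simp: inj_on_def)
    show "degree (P q) < card ((\<lambda>j. a + real j * w 1) ` {..<m})"
      "degree p < card ((\<lambda>j. a + real j * w 1) ` {..<m})"
      unfolding c p_def using P(1) q by auto
    fix x assume "x \<in> (\<lambda>j. a + real j * w 1) ` {..<m}"
    then obtain j where j: "j < m" "x = a + real j * w 1" by auto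
    have x': "x = a + real (j * q) * w q" using j q by (simp add: w_def)
    have "poly p x = f x" unfolding p_def using P(2)[of 1 j] j by simp
    moreover have "poly (P q) x = f x" using P(2)[OF q, of "j * q"] j(1) unfolding x' by simp
    ultimately show "poly (P q) x = poly p x" by simp
  qed
  have "f x = poly p x" if x: "x \<in> {a..b}" for x
  proof -
    \<comment> \<open>The last grid point not exceeding \<open>x\<close>; \<open>Suc q\<close>
      avoids the meaningless mesh \<open>w 0\<close>.\<close>
    define j where "j q = nat \<lfloor>(x - a) / w (Suc q)\<rfloor>" for q
    define z where "z q = a + real (j q) * w (Suc q)" for q
    have w': "w (Suc q) > 0" for q by (rule w) simp
    have jle: "real (j q) \<le> (x - a) / w (Suc q)" and jgt: "(x - a) / w (Suc q) < real (j q) + 1" for q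
      using x w'[of q] unfolding j_def by (auto simp: of_nat_nat)
    have "j q \<le> m * Suc q" for q
    proof -
      have "(x - a) / w (Suc q) \<le> (b - a) / w (Suc q)" using x w'[of q] by (intro divide_right_mono) auto
      also have "\<dots> = real m * real (Suc q)" using assms(1,2) by (simp add: w_def del: of_nat_Suc)
      also have "\<dots> = real (m * Suc q)" by (simp only: of_nat_mult)
      finally have "real (j q) \<le> real (m * Suc q)" using jle[of q] by linarith
      then show ?thesis by (simp only: of_nat_le_iff)
    qed
    then have fz: "f (z q) = poly p (z q)" for q
      using P(2)[of "Suc q" "j q"] Pq[of "Suc q"] by (simp add: z_def)
    have zle: "z q \<le> x" and zgt: "x - w (Suc q) \<le> z q" for q
      using jle[of q] jgt[of q] w'[of q] by (auto simp: z_def field_simps)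
    have "(\<lambda>q. (b - a) / real m * inverse (real (Suc q))) \<longlonglongrightarrow> 0"
      by (intro tendsto_mult_right_zero LIMSEQ_inverse_real_of_nat)
    then have "(\<lambda>q. x - w (Suc q)) \<longlonglongrightarrow> x - 0"
      by (intro tendsto_diff tendsto_const) (simp add: w_def field_simps)
    then have zx: "z \<longlonglongrightarrow> x"
      using zle zgt by (intro tendsto_sandwich[of "\<lambda>q. x - w (Suc q)" z _ "\<lambda>_. x" x]) auto
    have zab: "z q \<in> {a..b}" for q
      using zle[of q] x w'[of q] by (auto simp: z_def)
    have "(\<lambda>q. f (z q)) \<longlonglongrightarrow> f x"
      using cont x zx zab by (auto simp: continuous_on_sequentially comp_def)
    moreover have "(\<lambda>q. poly p (z q)) \<longlonglongrightarrow> poly p x"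
      by (intro tendsto_intros zx)
    ultimately show ?thesis unfolding fz by (rule LIMSEQ_unique)
  qed
  then show ?thesis by blast
qed

text \<open>Moving \<open>(u, v)\<close> by \<open>(h / (K - j), - j h / (K - j))\<close> fixes the point \<open>j u + v\<close> and moves
  \<open>K u + v\<close> by \<open>h\<close>, so one difference eliminates the term \<open>j\<close> from the functional equation.\<close>
lemma fwd_diff_zero_of_functional_equation:
  fixes \<phi> :: "nat \<Rightarrow> real \<Rightarrow> real" and h :: real
  assumes "finite D" "K \<notin> D"
    and "\<And>u v. \<bar>u - u0\<bar> < r \<Longrightarrow> \<bar>v - v0\<bar> < r \<Longrightarrow> \<phi> K (real K * u + v) + (\<Sum>k\<in>D. \<phi> k (real k * u + v)) = 0"
    and "\<bar>u - u0\<bar> < r - (\<Sum>j\<in>D. 1 + real j) * \<bar>h\<bar>" "\<bar>v - v0\<bar> < r - (\<Sum>j\<in>D. 1 + real j) * \<bar>h\<bar>"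
  shows "(fwd_diff h ^^ card D) (\<phi> K) (real K * u + v) = 0"
  using assms
proof (induction D arbitrary: \<phi> r rule: finite_induct)
  case empty
  then show ?case by simp
next
  case (insert j D)
  define s where "s = h / (real K - real j)"
  have Kj: "real K - real j \<noteq> 0" using insert.prems by auto
  have "1 \<le> \<bar>int K - int j\<bar>" using insert.prems by auto
  then have "real_of_int 1 \<le> of_int \<bar>int K - int j\<bar>" by (simp only: of_int_le_iff)
  then have "1 \<le> \<bar>real K - real j\<bar>" by simp
  then have sh: "\<bar>s\<bar> \<le> \<bar>h\<bar>"
    unfolding s_def abs_divide by (simp add: divide_le_eq mult_le_cancel_left1)
  \<comment> \<open>The move shifts the argument of term \<open>k\<close> by
    \<open>(k - j) * s\<close>: by 0 for \<open>j\<close> and by \<open>h\<close> for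
    \<open>K\<close>. The steps differ between terms, hence a separate function for each
    \<open>k\<close>.\<close>
  define \<phi>' where "\<phi>' k x = \<phi> k (x + (real k - real j) * s) - \<phi> k x" for k x
  have Ks: "(real K - real j) * s = h" using Kj by (simp add: s_def)
  \<comment> \<open>As the denominator is a nonzero integer, \<open>u\<close> moves by at most
    \<open>\<bar>h\<bar>\<close> and \<open>v\<close> by at most \<open>j * \<bar>h\<bar>\<close>;
    the radius shrinks by the sum of the two.\<close>
  define r' where "r' = r - (1 + real j) * \<bar>h\<bar>"
  have "(fwd_diff h ^^ card D) (\<phi>' K) (real K * u + v) = 0"
  proof (rule insert.IH[of r'])
    show "K \<notin> D" using insert by auto
    show "\<bar>u - u0\<bar> < r' - (\<Sum>j\<in>D. 1 + real j) * \<bar>h\<bar>" "\<bar>v - v0\<bar> < r' - (\<Sum>j\<in>D. 1 + real j) * \<bar>h\<bar>"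
      using insert by (auto simp: r'_def algebra_simps)
    fix u v assume uv: "\<bar>u - u0\<bar> < r'" "\<bar>v - v0\<bar> < r'"
    have jh: "0 \<le> real j * \<bar>h\<bar>" by simp
    have js: "\<bar>real j * s\<bar> \<le> real j * \<bar>h\<bar>" unfolding abs_mult using sh by (simp add: mult_left_mono)
    have r': "r' = r - \<bar>h\<bar> - real j * \<bar>h\<bar>" by (simp add: r'_def algebra_simps)
    have 1: "\<bar>u - u0\<bar> < r" using uv jh unfolding r' by linarith
    have 2: "\<bar>v - v0\<bar> < r" using uv jh unfolding r' by linarith
    have 3: "\<bar>u + s - u0\<bar> < r" using uv jh sh unfolding r' by linarith
    have 4: "\<bar>v - real j * s - v0\<bar> < r" using uv jh js unfolding r' by linarith
    have eq: "real k * (u + s) + (v - real j * s) = real k * u + v + (real k - real j) * s" for k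
      by (simp add: algebra_simps)
    have j0: "\<phi>' j (real j * u + v) = 0" by (simp add: \<phi>'_def)
    have "\<phi>' K (real K * u + v) + (\<Sum>k\<in>insert j D. \<phi>' k (real k * u + v)) = 0"
      using insert.prems(2)[OF 1 2] insert.prems(2)[OF 3 4]
      unfolding eq \<phi>'_def sum_subtractf by linarith
    then show "\<phi>' K (real K * u + v) + (\<Sum>k\<in>D. \<phi>' k (real k * u + v)) = 0"
      using insert j0 by simp
  qed
  also have "\<phi>' K = fwd_diff h (\<phi> K)"
    unfolding \<phi>'_def Ks fwd_diff_def ..
  finally show ?case
    using insert by (simp add: funpow_Suc_right del: funpow.simps)
qed

section \<open>From an integer relation on a box to a polynomial\<close>

text \<open>Dividing by \<open>c K\<close> turns the isolated term into \<open>f\<close> itself.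
  With \<open>u = u0\<close> fixed and \<open>v\<close> varying, \<open>K * u + v\<close> sweeps out
  an interval.\<close>

lemma locally_poly_of_functional_equation:
  fixes f :: "real \<Rightarrow> real" and c :: "nat \<Rightarrow> real"
  assumes "finite D" "K \<in> D" "c K \<noteq> 0" "0 < r" "r < v0" "0 < u0"
    and cont: "continuous_on {0<..} f"
    and eq: "\<And>u v. \<bar>u - u0\<bar> < r \<Longrightarrow> \<bar>v - v0\<bar> < r \<Longrightarrow> (\<Sum>k\<in>D. c k * f (real k * u + v)) = 0"
  shows "\<exists>a b. 0 < a \<and> a < b \<and> (\<exists>p. \<forall>x\<in>{a..b}. f x = poly p x)"
proof -
  define E where "E = D - {K}"
  define m where "m = card E"
  define S where "S = (\<Sum>j\<in>E. 1 + real j)"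
  define \<phi> where "\<phi> k x = c k / c K * f x" for k x
  have \<phi>K: "\<phi> K = f" using assms by (auto simp: \<phi>_def)
  have S: "0 \<le> S" unfolding S_def by (intro sum_nonneg) auto
  have E: "finite E" "K \<notin> E" using assms by (auto simp: E_def)
  have eqE: "\<phi> K (real K * u + v) + (\<Sum>k\<in>E. \<phi> k (real k * u + v)) = 0"
    if "\<bar>u - u0\<bar> < r" "\<bar>v - v0\<bar> < r" for u v
  proof -
    have "\<phi> K (real K * u + v) + (\<Sum>k\<in>E. \<phi> k (real k * u + v)) = (\<Sum>k\<in>D. \<phi> k (real k * u + v))"
      unfolding E_def using assms by (simp add: sum.remove[of D K])
    also have "\<dots> = (\<Sum>k\<in>D. c k * f (real k * u + v)) / c K"
      unfolding \<phi>_def by (simp add: sum_divide_distrib)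
    finally show ?thesis using eq[OF that] by simp
  qed
  have zero: "(fwd_diff h ^^ m) f (real K * u0 + v) = 0" if "\<bar>v - v0\<bar> < r - S * \<bar>h\<bar>" for h v
  proof -
    have "\<bar>u0 - u0\<bar> < r - S * \<bar>h\<bar>" using that by linarith
    with that have "(fwd_diff h ^^ card E) (\<phi> K) (real K * u0 + v) = 0"
      unfolding S_def
      by (auto intro!: fwd_diff_zero_of_functional_equation[where \<phi> = \<phi> and r = r and ?v0.0 = v0 and ?u0.0 = u0
            and D = E and K = K and u = u0 and v = v, OF E eqE])
    then show ?thesis by (simp add: m_def \<phi>K)
  qed
  \<comment> \<open>Half of \<open>r\<close> allows for the distance of \<open>v\<close> from
    \<open>v0\<close>, the other half for the loss \<open>S * \<bar>h\<bar>\<close>.\<close>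
  define w where "w = r / (2 * (1 + S))"
  have w: "0 < w" "S * w < r / 2" "w \<le> r / 2" using assms S by (auto simp: w_def field_simps)
  define a where "a = real K * u0 + v0"
  have a: "0 < a" using assms by (simp add: a_def add_nonneg_pos)
  have zero': "(fwd_diff h ^^ m) f x = 0" if "a \<le> x" "x \<le> a + w" "0 \<le> h" "h \<le> w" for x h
  proof -
    have "S * \<bar>h\<bar> \<le> S * w" using that S by (intro mult_left_mono) auto
    with that w have "\<bar>(x - real K * u0) - v0\<bar> < r - S * \<bar>h\<bar>" by (auto simp: a_def)
    from zero[OF this] show ?thesis by simp
  qed
  have "\<exists>p. \<forall>x\<in>{a..a + w}. f x = poly p x"
  \<comment> \<open>Here \<open>K\<close> is the only term, and the relation says that
    \<open>f\<close> is zero.\<close>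
  proof (cases "m = 0")
    case True
    then show ?thesis using zero'[of _ 0] w by (intro exI[of _ 0]) auto
  next
    case False
    show ?thesis
    proof (rule poly_on_interval_of_fwd_diff_zero)
      show "continuous_on {a..a + w} f"
        using cont by (rule continuous_on_subset) (use a in auto)
      fix x h assume xh: "a \<le> x" "0 < h" "x + real m * h \<le> a + w"
      have "1 * h \<le> real m * h" using False xh by (intro mult_right_mono) auto
      with xh show "(fwd_diff h ^^ m) f x = 0" by (intro zero'; linarith)
    qed (use False w in auto)
  qed
  with a w show ?thesis by (intro exI[of _ a] exI[of _ "a + w"]) auto
qed

text \<open>Each relation fails on a relatively open set, and no point lies in all of these sets. By
  Baire one of them is not dense, so its relation holds near some point.\<close>

lemma ex_integer_relation_on_box:
  fixes f :: "real \<Rightarrow> real"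
  assumes U: "open U" "U \<noteq> {}" "U \<subseteq> {0<..}" and V: "open V" "V \<noteq> {}" "V \<subseteq> {0<..}"
    and cont: "continuous_on {0<..} f"
    and rel: "\<And>u v. u \<in> U \<Longrightarrow> v \<in> V \<Longrightarrow> \<exists>N (c :: nat \<Rightarrow> int). (\<exists>k\<in>{1..N}. c k \<noteq> 0) \<and>
        (\<Sum>k=1..N. of_int (c k) * f (real k * u + v)) = 0"
  shows "\<exists>N (c :: nat \<Rightarrow> int) u0 v0 r. (\<exists>k\<in>{1..N}. c k \<noteq> 0) \<and> 0 < r \<and> r < v0 \<and> 0 < u0 \<and>
     (\<forall>u v. \<bar>u - u0\<bar> < r \<longrightarrow> \<bar>v - v0\<bar> < r \<longrightarrow> (\<Sum>k=1..N. of_int (c k) * f (real k * u + v)) = 0)"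
proof -
  obtain u1 where u1: "u1 \<in> U" using U by auto
  obtain v1 where v1: "v1 \<in> V" using V by auto
  obtain e1 where e1: "e1 > 0" "cball u1 e1 \<subseteq> U" using U u1 open_contains_cball by blast
  obtain e2 where e2: "e2 > 0" "cball v1 e2 \<subseteq> V" using V v1 open_contains_cball by blast
  define B where "B = cbox (u1 - e1, v1 - e2) (u1 + e1, v1 + e2)"
  have B: "B = cball u1 e1 \<times> cball v1 e2" by (simp add: B_def cbox_Pair_eq cball_eq_atLeastAtMost)
  have BUV: "B \<subseteq> U \<times> V" using e1 e2 by (auto simp: B)
  \<comment> \<open>Coefficients are extensional functions on \<open>{1..N}\<close>; the set of all
    integer sequences would be uncountable.\<close>
  define R where "R = (\<Union>N. {(N, c) | c :: nat \<Rightarrow> int. c \<in> PiE {1..N} (\<lambda>_. UNIV) \<and> (\<exists>k\<in>{1..N}. c k \<noteq> 0)})"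
  define g where "g = (\<lambda>(N, c :: nat \<Rightarrow> int) z. (\<Sum>k=1..N. of_int (c k) * f (real k * fst z + snd z)))"
  define O' where "O' q = {z\<in>B. g q z \<noteq> 0}" for q
  have "countable R"
  proof -
    have "countable (Pair N ` PiE {1..N} (\<lambda>_. UNIV :: int set))" for N :: nat
      by (intro countable_image countable_PiE) auto
    then have "countable (\<Union>N::nat. Pair N ` PiE {1..N} (\<lambda>_. UNIV :: int set))" by auto
    then show ?thesis by (rule countable_subset[rotated]) (auto simp: R_def)
  qed
  have gcont: "continuous_on B (g q)" for q
  proof -
    have "continuous_on B (\<lambda>z. f (real k * fst z + snd z))" for k
    proof (rule continuous_on_compose2[OF cont])
      show "continuous_on B (\<lambda>z. real k * fst z + snd z)" by (intro continuous_intros)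
      show "(\<lambda>z. real k * fst z + snd z) ` B \<subseteq> {0<..}"
      proof (rule image_subsetI)
        fix z assume "z \<in> B"
        then have "fst z \<in> U" "snd z \<in> V" using BUV by auto
        then have "0 < fst z" "0 < snd z" using U V by auto
        then show "real k * fst z + snd z \<in> {0<..}" by (simp add: add_nonneg_pos)
      qed
    qed
    then show ?thesis unfolding g_def by (cases q) (auto intro!: continuous_intros)
  qed
  have opn: "openin (top_of_set B) (O' q)" for q
  proof -
    have "openin (top_of_set B) (B \<inter> g q -` (- {0}))"
      using gcont by (rule continuous_openin_preimage_gen) auto
    moreover have "B \<inter> g q -` (- {0}) = O' q" by (auto simp: O'_def)
    ultimately show ?thesis by simp
  qed
  have "\<exists>q\<in>R. \<not> B \<subseteq> closure (O' q)"
  proof (rule ccontr)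
    assume "\<not> ?thesis"
    then have "B \<subseteq> closure (\<Inter> (O' ` R))"
      using \<open>countable R\<close> opn by (intro Baire) (auto simp: B_def)
    moreover have "B \<noteq> {}" using e1 e2 by (auto simp: B)
    ultimately have "\<Inter> (O' ` R) \<noteq> {}" by auto
    \<comment> \<open>A nonempty index set ensures that the intersection lies inside
      \<open>B\<close>.\<close>
    moreover have "R \<noteq> {}"
      unfolding R_def by (auto intro!: exI[of _ "1::nat"] exI[of _ "\<lambda>k\<in>{1..1}. 1"])
    ultimately obtain z where z: "z \<in> B" "\<And>q. q \<in> R \<Longrightarrow> g q z \<noteq> 0" by (auto simp: O'_def)
    obtain u v where uv: "z = (u, v)" "u \<in> U" "v \<in> V" using z(1) BUV by (cases z) auto
    from rel[OF uv(2,3)] obtain N and c :: "nat \<Rightarrow> int" where c: "\<exists>k\<in>{1..N}. c k \<noteq> 0"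
      "(\<Sum>k=1..N. of_int (c k) * f (real k * u + v)) = 0" by blast
    have "(N, restrict c {1..N}) \<in> R" using c(1) by (auto simp: R_def)
    moreover have "g (N, restrict c {1..N}) z = 0" using c(2) uv by (simp add: g_def)
    ultimately show False using z by blast
  qed
  then obtain q z where q: "q \<in> R" "z \<in> B" "z \<notin> closure (O' q)" by blast
  then obtain N and c :: "nat \<Rightarrow> int" where Nc: "q = (N, c)" and c: "\<exists>k\<in>{1..N}. c k \<noteq> 0"
    by (auto simp: R_def)
  have z: "z \<in> B" "z \<notin> closure (O' (N, c))" using q Nc by auto
  \<comment> \<open>\<open>z\<close> may lie on the boundary of \<open>B\<close>; the open box is
    dense in \<open>B\<close>, so an interior point can replace it.\<close>
  have "z \<in> closure (box (u1 - e1, v1 - e2) (u1 + e1, v1 + e2))"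
    using z(1) e1 e2 unfolding B_def by (subst closure_box) (auto simp: box_ne_empty Basis_prod_def)
  then have "(- closure (O' (N, c))) \<inter> box (u1 - e1, v1 - e2) (u1 + e1, v1 + e2) \<noteq> {}" (is "?W \<noteq> {}")
    using z(2) by (subst open_Int_closure_eq_empty[symmetric]) auto
  then obtain z0 where z0: "z0 \<in> ?W" by blast
  have "open ?W" by (intro open_Int open_box) auto
  then obtain e where e: "e > 0" "ball z0 e \<subseteq> ?W" using z0 open_contains_ball by blast
  define u0 v0 where "u0 = fst z0" and "v0 = snd z0"
  have WB: "?W \<subseteq> B" unfolding B_def using box_subset_cbox by blast
  have z0B: "u0 \<in> U" "v0 \<in> V" using z0 WB BUV by (auto simp: u0_def v0_def)
  then have pos: "0 < u0" "0 < v0" using U V by auto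
  \<comment> \<open>The bound \<open>e / 2\<close> in each coordinate keeps the point within
    distance \<open>e\<close> of \<open>z0\<close>; \<open>v0 / 2\<close> yields
    \<open>r < v0\<close>.\<close>
  define r where "r = min (e / 2) (v0 / 2)"
  have r: "0 < r" "r < v0" "r \<le> e / 2" using e pos by (auto simp: r_def)
  have "(\<Sum>k=1..N. of_int (c k) * f (real k * u + v)) = 0" if "\<bar>u - u0\<bar> < r" "\<bar>v - v0\<bar> < r" for u v
  proof -
    have "dist z0 (u, v) \<le> dist u0 u + dist v0 v"
      by (cases z0) (auto simp: u0_def v0_def dist_Pair_Pair intro: sqrt_sum_squares_le_sum)
    also have "\<dots> < e" using that r by (auto simp: dist_real_def)
    finally have "(u, v) \<in> ?W" using e by (auto simp: subset_iff)
    then have "(u, v) \<in> B" "(u, v) \<notin> O' (N, c)" using WB closure_subset by auto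
    then show ?thesis by (simp add: O'_def g_def)
  qed
  with c r pos show ?thesis by blast
qed

theorem theorem2:
  fixes U V :: "real set" and f :: "real \<Rightarrow> real"
  assumes "open U" "U \<noteq> {}" "U \<subseteq> {0<..}"
    and "open V" "V \<noteq> {}" "V \<subseteq> {0<..}"
    and "continuous_on {0<..} f"
    and "\<forall>u\<in>U. \<forall>v\<in>V. pointwise_good (\<lambda>k. f (real k * u + v))"
  shows "\<exists>a b. 0 < a \<and> a < b \<and> (\<exists>p :: real poly. \<forall>x\<in>{a..b}. f x = poly p x)"
proof -
  have "\<exists>N (c :: nat \<Rightarrow> int). (\<exists>k\<in>{1..N}. c k \<noteq> 0) \<and> (\<Sum>k=1..N. of_int (c k) * f (real k * u + v)) = 0"
    if "u \<in> U" "v \<in> V" for u v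
    using that assms(8) by (intro ex_integer_relation_of_pointwise_good) auto
  from ex_integer_relation_on_box[OF assms(1-7) this]
  obtain N u0 v0 r and c :: "nat \<Rightarrow> int" where c: "\<exists>k\<in>{1..N}. c k \<noteq> 0" and r: "0 < r" "r < v0" "0 < u0"
    and eq: "\<And>u v. \<bar>u - u0\<bar> < r \<Longrightarrow> \<bar>v - v0\<bar> < r \<Longrightarrow> (\<Sum>k=1..N. of_int (c k) * f (real k * u + v)) = 0"
    by blast
  from c obtain K where K: "K \<in> {1..N}" "real_of_int (c K) \<noteq> 0" by auto
  show ?thesis
    by (rule locally_poly_of_functional_equation[OF _ K r assms(7) eq]) auto
qed

end
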